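(* Let $X$ be a Banach space and let $K\subset B_X$ be a (nonempty) compact convex subset. If $X$ is $K$-URED, then the nearest point map from $B_X$ onto $K$ is uniformly continuous.
   Context: All Banach spaces are real; $B_X$ is the closed unit ball. A normed space $X$ is uniformly rotund in the direction $z\in X$ if whenever $(x_n),(y_n)$ are sequences in $X$ with $\|x_n\|=\|y_n\|=1$, $\lim_n\|\frac{x_n+y_n}{2}\|=1$, and $x_n-y_n=r_nz$ for some real numbers $r_n$, then $\lim_n\|x_n-y_n\|=0$. Given $K\subset X$, $X$ is $K$-URED if it is uniformly rotund in the direction $z$ for every $z\in\mathrm{span}(K)$. A nearest point map from $B_X$ onto $K$ is a map $R:B_X\to K$ with $\|R(x)-x\|=\inf_{y\in K}\|y-x\|$ for all $x\in B_X$. *)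

theory Defs
  imports "HOL-Analysis.Analysis"
begin

definition uniformly_rotund_in_direction :: "'a::real_normed_vector \<Rightarrow> bool" where
  "uniformly_rotund_in_direction z \<longleftrightarrow>
    (\<forall>(x :: nat \<Rightarrow> 'a) (y :: nat \<Rightarrow> 'a) (r :: nat \<Rightarrow> real).
      (\<forall>n. norm (x n) = 1) \<longrightarrow> (\<forall>n. norm (y n) = 1) \<longrightarrow>
      (\<lambda>n. norm ((1 / 2) *\<^sub>R (x n + y n))) \<longlonglongrightarrow> 1 \<longrightarrow>
      (\<forall>n. x n - y n = r n *\<^sub>R z) \<longrightarrow>
      (\<lambda>n. norm (x n - y n)) \<longlonglongrightarrow> 0)"

definition URED_wrt :: "'a::real_normed_vector set \<Rightarrow> bool" where
  "URED_wrt K \<longleftrightarrow> (\<forall>z \<in> span K. uniformly_rotund_in_direction z)"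

text \<open>Only the values of \<open>R\<close> on the closed unit ball matter. The infimum is meaningful only for
  nonempty \<open>K\<close>; for \<open>K = {}\<close> the predicate is false.\<close>

definition nearest_point_map :: "'a::real_normed_vector set \<Rightarrow> ('a \<Rightarrow> 'a) \<Rightarrow> bool" where
  "nearest_point_map K R \<longleftrightarrow>
    (\<forall>x \<in> cball 0 1. R x \<in> K \<and> norm (R x - x) = (INF y\<in>K. norm (y - x)))"

end

theory Submission
  imports Defs
begin

text \<open>If uniform continuity of the nearest point map fails, compactness yields points \<open>x\<^sub>n\<close> whose
  distances to \<open>K\<close> converge to some \<open>d\<close>, together with two distinct points \<open>a, b\<close> of \<open>K\<close> such that
  \<open>\<parallel>x\<^sub>n - a\<parallel>\<close> and \<open>\<parallel>x\<^sub>n - b\<parallel>\<close> converge to \<open>d\<close>. Convexity of \<open>K\<close> forces the distance to the midpoint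
  of \<open>a\<close> and \<open>b\<close> to converge to \<open>d\<close> as well. The vectors \<open>x\<^sub>n - a\<close> and \<open>x\<^sub>n - b\<close> differ by the fixed
  vector \<open>b - a \<in> span K\<close>, so rotundity in this direction is contradicted once both are pushed outwards
  along their common line to a sphere. Uniqueness is the case of a constant sequence.\<close>

lemma exists_norm_add_scaleR_eq:
  fixes u z :: "'a::real_normed_vector"
  assumes "z \<noteq> 0" and "norm u \<le> M"
  obtains t where "0 \<le> t" and "norm (u + t *\<^sub>R z) = M"
proof -
  \<comment> \<open>Chosen so that \<open>T *\<^sub>R z\<close> has norm \<open>M + norm u\<close>:
    by the reverse triangle inequality the ray has left the open ball of radius \<open>M\<close> by
    time \<open>T\<close>, and the intermediate value theorem applies on
    \<open>{0..T}\<close>.\<close>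
  define T where "T = (M + norm u) / norm z"
  have M: "0 \<le> M"
    using assms(2) norm_ge_zero order_trans by blast
  have T: "0 \<le> T"
    using M by (simp add: T_def)
  have "norm (T *\<^sub>R z) = M + norm u"
    using assms(1) M by (simp add: T_def)
  then have "M \<le> norm (u + T *\<^sub>R z)"
    using norm_triangle_ineq2[of "T *\<^sub>R z" "- u"] by (simp add: add.commute)
  moreover have "continuous_on {0..T} (\<lambda>t. norm (u + t *\<^sub>R z))"
    by (intro continuous_intros)
  ultimately obtain t where "0 \<le> t" "norm (u + t *\<^sub>R z) = M"
    using IVT'[of "\<lambda>t. norm (u + t *\<^sub>R z)" 0 M T] assms(2) T by auto
  then show ?thesis
    by (rule that)
qed

text \<open>Among the points \<open>p, q\<close> of the sphere, the midpoint of \<open>u, v\<close> lies between the midpoint of \<open>p, q\<close>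
  and one of \<open>p, q\<close>; convexity of the norm along that segment gives the last estimate.\<close>

lemma extend_chord_to_sphere:
  fixes u v z :: "'a::real_normed_vector"
  assumes "z \<noteq> 0" and "u - v = z" and "norm u \<le> M" and "norm v \<le> M"
  obtains p q r where "norm p = M" and "norm q = M" and "p - q = r *\<^sub>R z" and "1 \<le> r"
    and "M - norm ((1 / 2) *\<^sub>R (p + q)) \<le> r * (M - norm ((1 / 2) *\<^sub>R (u + v)))"
proof -
  obtain t where t: "0 \<le> t" "norm (u + t *\<^sub>R z) = M"
    using exists_norm_add_scaleR_eq[OF assms(1,3)] .
  obtain s where s: "0 \<le> s" "norm (v + s *\<^sub>R - z) = M"
    using exists_norm_add_scaleR_eq[of "- z" v M] assms(1,4) by auto
  define p q r where "p = u + t *\<^sub>R z" and "q = v - s *\<^sub>R z" and "r = 1 + t + s"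
  define m m' where "m = (1 / 2) *\<^sub>R (u + v)" and "m' = (1 / 2) *\<^sub>R (p + q)"
  have pM: "norm p = M" and qM: "norm q = M"
    using t s by (simp_all add: p_def q_def)
  have r: "1 \<le> r"
    using t s by (simp add: r_def)
  have u: "u = v + z"
    using assms(2) by (simp add: algebra_simps)
  have diff: "p - q = r *\<^sub>R z"
    by (simp add: p_def q_def r_def u algebra_simps)
  have m'M: "norm m' \<le> M"
    using norm_triangle_ineq[of p q] pM qM by (simp add: m'_def)
  \<comment> \<open>Here \<open>l / r\<close> is the weight of \<open>m'\<close> when
    \<open>m\<close> is written as a convex combination of \<open>m'\<close> and the endpoint
    \<open>w\<close>. Convexity gives the estimate with a factor \<open>l\<close> on the left, which
    is dropped because \<open>1 \<le> l\<close>.\<close>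
  have est: "M - norm m' \<le> r * (M - norm m)"
    if w: "norm w = M" and l: "1 \<le> l" "l \<le> r" and eq: "r *\<^sub>R m = l *\<^sub>R m' + (r - l) *\<^sub>R w" for w l
  proof -
    have "r * norm m = norm (l *\<^sub>R m' + (r - l) *\<^sub>R w)"
      using eq r by (metis abs_of_nonneg norm_scaleR order_trans zero_le_one)
    also have "\<dots> \<le> l * norm m' + (r - l) * M"
      using norm_triangle_ineq[of "l *\<^sub>R m'" "(r - l) *\<^sub>R w"] w l by simp
    finally have "l * (M - norm m') \<le> r * (M - norm m)"
      by (simp add: algebra_simps)
    moreover have "1 * (M - norm m') \<le> l * (M - norm m')"
      using l m'M by (intro mult_right_mono) auto
    ultimately show ?thesis
      by simp
  qed
  \<comment> \<open>Positions on the chord are measured from \<open>q\<close> in multiples of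
    \<open>z\<close>: \<open>v\<close> sits at \<open>s\<close>, \<open>u\<close> at
    \<open>s + 1\<close>, \<open>p\<close> at \<open>r\<close>. Comparing \<open>s + 1 / 2\<close>
    with \<open>r / 2\<close> shows that \<open>s \<le> t\<close> puts \<open>m\<close> between
    \<open>q\<close> and \<open>m'\<close>, and otherwise \<open>m\<close> lies between
    \<open>m'\<close> and \<open>p\<close>.\<close>
  have m: "m = q + (s + 1 / 2) *\<^sub>R z"
    by (simp add: m_def q_def u algebra_simps flip: scaleR_2)
  have p: "p = q + r *\<^sub>R z"
    using diff by (simp add: algebra_simps)
  have m': "m' = q + (r / 2) *\<^sub>R z"
    by (simp add: m'_def p algebra_simps flip: scaleR_2)
  have "M - norm m' \<le> r * (M - norm m)"
  proof (cases "s \<le> t")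
    case True
    have "r *\<^sub>R m = (2 * s + 1) *\<^sub>R m' + (r - (2 * s + 1)) *\<^sub>R q"
      by (simp add: m m' algebra_simps)
    with True s show ?thesis
      by (intro est[OF qM, of "2 * s + 1"]) (auto simp: r_def)
  next
    case False
    \<comment> \<open>Since \<open>p\<close> is itself \<open>q + r *\<^sub>R z\<close>, the convex
      combination is verified by comparing the coefficients of \<open>z\<close> and of
      \<open>q\<close> separately.\<close>
    have "r * (s + 1 / 2) = (2 * t + 1) * (r / 2) + (r - (2 * t + 1)) * r"
      by (simp add: r_def field_simps)
    then have "(r * (s + 1 / 2)) *\<^sub>R z
        = ((2 * t + 1) * (r / 2)) *\<^sub>R z + ((r - (2 * t + 1)) * r) *\<^sub>R z"
      by (metis scaleR_add_left)
    moreover have "r *\<^sub>R q = (2 * t + 1) *\<^sub>R q + (r - (2 * t + 1)) *\<^sub>R q"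
      by (simp flip: scaleR_add_left)
    ultimately have "r *\<^sub>R m = (2 * t + 1) *\<^sub>R m' + (r - (2 * t + 1)) *\<^sub>R p"
      unfolding m m' p scaleR_add_right scaleR_scaleR by simp
    with False t show ?thesis
      by (intro est[OF pM, of "2 * t + 1"]) (auto simp: r_def)
  qed
  then show ?thesis
    using that[OF pM qM diff r] by (simp add: m_def m'_def)
qed

text \<open>Rotundity speaks of unit vectors, whereas the norms here only converge to a common
  limit. Pushing both vectors out to the sphere of radius \<open>M n\<close> and dividing by
  \<open>M n\<close> repairs this. The midpoint defect grows at most by the factor
  \<open>r n\<close>, which stays bounded, so it still tends to 0, while the distance of the
  normalised points is at least \<open>norm z / M n\<close> and cannot vanish in the limit.\<close>

lemma uniformly_rotund_in_direction_limit:
  fixes u v :: "nat \<Rightarrow> 'a::real_normed_vector"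
  assumes rot: "uniformly_rotund_in_direction z" and diff: "\<And>n. u n - v n = z"
    and u: "(\<lambda>n. norm (u n)) \<longlonglongrightarrow> d" and v: "(\<lambda>n. norm (v n)) \<longlonglongrightarrow> d"
    and mid: "(\<lambda>n. norm ((1 / 2) *\<^sub>R (u n + v n))) \<longlonglongrightarrow> d"
  shows "z = 0"
proof (rule ccontr)
  assume z: "z \<noteq> 0"
  define M where "M n = max (norm (u n)) (norm (v n))" for n
  have M: "M \<longlonglongrightarrow> d"
    using tendsto_max[OF u v] by (simp add: M_def[abs_def])
  \<comment> \<open>Two vectors differing by a nonzero \<open>z\<close> cannot both be short; this
    keeps \<open>M n\<close> and its limit \<open>d\<close> positive and permits the divisions
    below.\<close>
  have z_le: "norm z \<le> 2 * M n" for n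
    using norm_triangle_ineq4[of "u n" "v n"] by (simp add: diff M_def)
  have Mpos: "0 < M n" for n
    using z_le[of n] z by (smt (verit) zero_less_norm_iff)
  have "norm z \<le> 2 * d"
    using z_le by (intro LIMSEQ_le_const[OF tendsto_mult_left[OF M]]) auto
  then have d: "0 < d"
    using z by (smt (verit) zero_less_norm_iff)
  have "\<exists>p q r. norm p = M n \<and> norm q = M n \<and> p - q = r *\<^sub>R z \<and> 1 \<le> r
      \<and> M n - norm ((1 / 2) *\<^sub>R (p + q)) \<le> r * (M n - norm ((1 / 2) *\<^sub>R (u n + v n)))" for n
    by (rule extend_chord_to_sphere[OF z diff, of n "M n"]) (auto simp: M_def)
  then obtain p q r where p: "\<And>n. norm (p n) = M n" and q: "\<And>n. norm (q n) = M n"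
    and pq: "\<And>n. p n - q n = r n *\<^sub>R z" and r: "\<And>n. 1 \<le> r n"
    and est: "\<And>n. M n - norm ((1 / 2) *\<^sub>R (p n + q n))
        \<le> r n * (M n - norm ((1 / 2) *\<^sub>R (u n + v n)))"
    by metis
  \<comment> \<open>A chord of a ball of radius \<open>M n\<close> has length at most the diameter,
    so the factor in \<open>est\<close> is bounded by a convergent sequence.\<close>
  have r_le: "r n \<le> 2 * M n / norm z" for n
  proof -
    have "r n * norm z \<le> 2 * M n"
      using norm_triangle_ineq4[of "p n" "q n"] r[of n] by (simp add: pq p q)
    then show ?thesis
      using z by (simp add: field_simps)
  qed
  have mid_uv: "norm ((1 / 2) *\<^sub>R (u n + v n)) \<le> M n" for n
    using norm_triangle_ineq[of "u n" "v n"] by (simp add: M_def)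
  have mid_pq: "norm ((1 / 2) *\<^sub>R (p n + q n)) \<le> M n" for n
    using norm_triangle_ineq[of "p n" "q n"] by (simp add: p q)
  have upper: "(\<lambda>n. 2 * M n / norm z * (M n - norm ((1 / 2) *\<^sub>R (u n + v n)))) \<longlonglongrightarrow> 2 * d / norm z * (d - d)"
    by (intro tendsto_intros M mid) (use z in auto)
  have "(\<lambda>n. M n - norm ((1 / 2) *\<^sub>R (p n + q n))) \<longlonglongrightarrow> 0"
  proof (rule tendsto_sandwich[OF _ _ tendsto_const])
    show "\<forall>\<^sub>F n in sequentially. 0 \<le> M n - norm ((1 / 2) *\<^sub>R (p n + q n))"
      using mid_pq by simp
    show "\<forall>\<^sub>F n in sequentially. M n - norm ((1 / 2) *\<^sub>R (p n + q n))
        \<le> 2 * M n / norm z * (M n - norm ((1 / 2) *\<^sub>R (u n + v n)))"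
      using r_le mid_uv by (intro always_eventually allI order_trans[OF est] mult_right_mono) auto
    show "(\<lambda>n. 2 * M n / norm z * (M n - norm ((1 / 2) *\<^sub>R (u n + v n)))) \<longlonglongrightarrow> 0"
      using upper by simp
  qed
  from tendsto_diff[OF M this] have "(\<lambda>n. norm ((1 / 2) *\<^sub>R (p n + q n))) \<longlonglongrightarrow> d"
    by simp
  from tendsto_divide[OF this M] have "(\<lambda>n. norm ((1 / 2) *\<^sub>R (p n + q n)) / M n) \<longlonglongrightarrow> 1"
    using d by simp
  moreover have "norm ((1 / 2) *\<^sub>R (p n + q n)) / M n
      = norm ((1 / 2) *\<^sub>R ((1 / M n) *\<^sub>R p n + (1 / M n) *\<^sub>R q n))" for n
    using Mpos[of n] by (simp flip: scaleR_add_right)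
  ultimately have "(\<lambda>n. norm ((1 / 2) *\<^sub>R ((1 / M n) *\<^sub>R p n + (1 / M n) *\<^sub>R q n))) \<longlonglongrightarrow> 1"
    by (simp only:)
  moreover have "norm ((1 / M n) *\<^sub>R p n) = 1" "norm ((1 / M n) *\<^sub>R q n) = 1" for n
    using Mpos[of n] by (simp_all add: p q)
  moreover have scaled: "(1 / M n) *\<^sub>R p n - (1 / M n) *\<^sub>R q n = (r n / M n) *\<^sub>R z" for n
    by (simp add: pq flip: scaleR_diff_right)
  ultimately have "(\<lambda>n. norm ((1 / M n) *\<^sub>R p n - (1 / M n) *\<^sub>R q n)) \<longlonglongrightarrow> 0"
    using rot[unfolded uniformly_rotund_in_direction_def, rule_format,
        of "\<lambda>n. (1 / M n) *\<^sub>R p n" "\<lambda>n. (1 / M n) *\<^sub>R q n" "\<lambda>n. r n / M n"]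
    by (simp only:)
  then have lim: "(\<lambda>n. r n / M n * norm z) \<longlonglongrightarrow> 0"
    using Mpos r unfolding scaled by (simp add: abs_of_pos order_less_le_trans[OF zero_less_one])
  have "(\<lambda>n. norm z / M n) \<longlonglongrightarrow> norm z / d"
    using d by (intro tendsto_intros M) auto
  then have "norm z / d \<le> 0"
  proof (rule LIMSEQ_le[OF _ lim], intro exI allI impI)
    show "norm z / M n \<le> r n / M n * norm z" for n
      using mult_right_mono[OF r[of n], of "norm z / M n"] Mpos[of n] by simp
  qed
  then show False
    using z d by (simp add: field_simps)
qed

text \<open>The midpoint of \<open>a\<close> and \<open>b\<close> lies in \<open>K\<close>, so its
  distance to \<open>x n\<close> is squeezed between \<open>infdist (x n) K\<close> and the average
  of the distances to \<open>a\<close> and \<open>b\<close>. Letting \<open>x\<close> vary with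
  \<open>n\<close> serves both uniform continuity and uniqueness.\<close>

lemma URED_wrt_asymptotically_nearest_unique:
  fixes K :: "'a::real_normed_vector set"
  assumes "convex K" and "URED_wrt K" and a: "a \<in> K" and b: "b \<in> K"
    and d: "(\<lambda>n. infdist (x n) K) \<longlonglongrightarrow> d"
    and xa: "(\<lambda>n. norm (x n - a)) \<longlonglongrightarrow> d" and xb: "(\<lambda>n. norm (x n - b)) \<longlonglongrightarrow> d"
  shows "a = b"
proof -
  have "b - a \<in> span K"
    using a b by (intro span_diff span_base)
  then have rot: "uniformly_rotund_in_direction (b - a)"
    using assms(2) by (simp add: URED_wrt_def)
  have mK: "(1 / 2) *\<^sub>R a + (1 / 2) *\<^sub>R b \<in> K"
    using convexD[OF assms(1) a b, of "1 / 2" "1 / 2"] by simp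
  have eq: "x n - ((1 / 2) *\<^sub>R a + (1 / 2) *\<^sub>R b) = (1 / 2) *\<^sub>R ((x n - a) + (x n - b))" for n
    by (simp add: algebra_simps flip: scaleR_2)
  have low: "infdist (x n) K \<le> norm ((1 / 2) *\<^sub>R ((x n - a) + (x n - b)))" for n
    using infdist_le[OF mK, of "x n"] unfolding dist_norm eq .
  have up: "norm ((1 / 2) *\<^sub>R ((x n - a) + (x n - b))) \<le> (norm (x n - a) + norm (x n - b)) / 2" for n
    using norm_triangle_ineq[of "x n - a" "x n - b"] by simp
  have "(\<lambda>n. (norm (x n - a) + norm (x n - b)) / 2) \<longlonglongrightarrow> (d + d) / 2"
    by (intro tendsto_intros xa xb) auto
  then have upper: "(\<lambda>n. (norm (x n - a) + norm (x n - b)) / 2) \<longlonglongrightarrow> d"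
    by simp
  have "(\<lambda>n. norm ((1 / 2) *\<^sub>R ((x n - a) + (x n - b)))) \<longlonglongrightarrow> d"
    by (rule tendsto_sandwich[OF _ _ d upper]) (use low up in auto)
  then have "b - a = 0"
    by (intro uniformly_rotund_in_direction_limit[OF rot _ xa xb]) simp
  then show ?thesis
    by simp
qed

lemma nearest_point_map_iff_infdist:
  assumes "K \<noteq> {}"
  shows "nearest_point_map K R \<longleftrightarrow> (\<forall>x \<in> cball 0 1. R x \<in> K \<and> norm (x - R x) = infdist x K)"
  using assms by (simp add: nearest_point_map_def infdist_notempty dist_norm norm_minus_commute)

lemma nearest_point_map_uniformly_continuous:
  fixes K :: "'a::real_normed_vector set"
  assumes ne: "K \<noteq> {}" and K: "K \<subseteq> cball 0 1" "compact K" "convex K" "URED_wrt K"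
    and "nearest_point_map K R"
  shows "uniformly_continuous_on (cball 0 1) R"
proof (rule ccontr)
  have RK: "R x \<in> K" and R: "norm (x - R x) = infdist x K" if "x \<in> cball 0 1" for x
    using assms(6) that by (auto simp: nearest_point_map_iff_infdist[OF ne])
  assume "\<not> uniformly_continuous_on (cball 0 1) R"
  then obtain e where e: "0 < e" and bad: "\<And>\<delta>. 0 < \<delta> \<Longrightarrow>
      \<exists>x\<in>cball 0 1. \<exists>y\<in>cball 0 1. dist y x < \<delta> \<and> e \<le> dist (R y) (R x)"
    unfolding uniformly_continuous_on_def by (meson not_less)
  have "\<exists>x y. x \<in> cball 0 1 \<and> y \<in> cball 0 1 \<and> dist y x < inverse (real (Suc n))
      \<and> e \<le> dist (R y) (R x)" for n
  proof -
    have "0 < inverse (real (Suc n))"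
      by simp
    from bad[OF this] show ?thesis
      by blast
  qed
  then obtain x y where x: "\<And>n. x n \<in> cball 0 1" and y: "\<And>n. y n \<in> cball 0 1"
    and xy: "\<And>n. dist (y n) (x n) < inverse (real (Suc n))"
    and Rxy: "\<And>n. e \<le> dist (R (y n)) (R (x n))"
    by metis
  have inf2: "infdist (x n) K \<in> {0..2}" for n
  proof -
    have "norm (x n - R (x n)) \<le> 1 + 1"
      using x[of n] RK[OF x[of n]] K(1) by (intro norm_triangle_le_diff add_mono) auto
    then show ?thesis
      by (simp add: R[OF x] infdist_nonneg)
  qed
  \<comment> \<open>The points \<open>x n\<close> need not have a convergent subsequence, but their
    nearest points and distances live in compact sets. Taking the product gives one subsequence
    along which all three converge.\<close>
  have "compact (K \<times> K \<times> {0..2::real})"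
    using K(2) by (intro compact_Times) auto
  moreover have "(R (x n), R (y n), infdist (x n) K) \<in> K \<times> K \<times> {0..2}" for n
    using RK x y inf2 by auto
  ultimately obtain l and k :: "nat \<Rightarrow> nat" where l: "l \<in> K \<times> K \<times> {0..2}" and k: "strict_mono k"
    and lim: "((\<lambda>n. (R (x n), R (y n), infdist (x n) K)) \<circ> k) \<longlonglongrightarrow> l"
    unfolding compact_def by meson
  obtain a b d where l_eq: "l = (a, b, d)"
    using prod_cases3 by blast
  have a: "a \<in> K" and b: "b \<in> K"
    using l by (auto simp: l_eq)
  have Ra: "(\<lambda>n. R (x (k n))) \<longlonglongrightarrow> a"
    using tendsto_fst[OF lim] by (simp add: l_eq o_def)
  have Rb: "(\<lambda>n. R (y (k n))) \<longlonglongrightarrow> b"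
    using tendsto_fst[OF tendsto_snd[OF lim]] by (simp add: l_eq o_def)
  have d: "(\<lambda>n. infdist (x (k n)) K) \<longlonglongrightarrow> d"
    using tendsto_snd[OF tendsto_snd[OF lim]] by (simp add: l_eq o_def)
  have "(\<lambda>n. dist (y n) (x n)) \<longlonglongrightarrow> 0"
    by (rule tendsto_sandwich[OF _ _ tendsto_const LIMSEQ_inverse_real_of_nat])
      (use xy in \<open>auto intro!: always_eventually less_imp_le simp del: of_nat_Suc\<close>)
  from LIMSEQ_subseq_LIMSEQ[OF this k] have yx: "(\<lambda>n. dist (y (k n)) (x (k n))) \<longlonglongrightarrow> 0"
    by (simp add: o_def)
  have Ra0: "(\<lambda>n. dist (R (x (k n))) a) \<longlonglongrightarrow> 0" and Rb0: "(\<lambda>n. dist (R (y (k n))) b) \<longlonglongrightarrow> 0"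
    using Ra Rb by (simp_all flip: tendsto_dist_iff)
  have low: "infdist (x (k n)) K \<le> norm (x (k n) - c)" if "c \<in> K" for n c
    using infdist_le[OF that] by (simp add: dist_norm)
  have "(\<lambda>n. norm (x (k n) - a)) \<longlonglongrightarrow> d"
  proof (rule tendsto_sandwich[OF _ _ d])
    show "\<forall>\<^sub>F n in sequentially. norm (x (k n) - a) \<le> infdist (x (k n)) K + dist (R (x (k n))) a"
      using dist_triangle[of "x (k _)" a "R (x (k _))"]
      by (intro always_eventually allI) (simp add: R[OF x, symmetric] flip: dist_norm)
    show "(\<lambda>n. infdist (x (k n)) K + dist (R (x (k n))) a) \<longlonglongrightarrow> d"
      using tendsto_add[OF d Ra0] by simp
  qed (use low a in auto)
  moreover have "(\<lambda>n. norm (x (k n) - b)) \<longlonglongrightarrow> d"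
  proof (rule tendsto_sandwich[OF _ _ d])
    \<comment> \<open>The factor 2 pays for moving from \<open>x (k n)\<close> to
      \<open>y (k n)\<close> and back: once in the triangle inequality, once because
      \<open>infdist\<close> is 1-Lipschitz.\<close>
    have "norm (x (k n) - b)
        \<le> infdist (x (k n)) K + 2 * dist (y (k n)) (x (k n)) + dist (R (y (k n))) b" for n
    proof -
      have "infdist (y (k n)) K \<le> infdist (x (k n)) K + dist (y (k n)) (x (k n))"
        by (rule infdist_triangle)
      moreover have "dist (y (k n)) (R (y (k n))) = infdist (y (k n)) K"
        using R[OF y] by (simp add: dist_norm)
      moreover have "dist (x (k n)) b
          \<le> dist (y (k n)) (x (k n)) + dist (y (k n)) (R (y (k n))) + dist (R (y (k n))) b"
        by metric
      ultimately show ?thesis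
        by (simp flip: dist_norm)
    qed
    then show "\<forall>\<^sub>F n in sequentially. norm (x (k n) - b)
        \<le> infdist (x (k n)) K + 2 * dist (y (k n)) (x (k n)) + dist (R (y (k n))) b"
      by simp
    show "(\<lambda>n. infdist (x (k n)) K + 2 * dist (y (k n)) (x (k n)) + dist (R (y (k n))) b) \<longlonglongrightarrow> d"
      using tendsto_add[OF tendsto_add[OF d tendsto_mult_left[OF yx, of 2]] Rb0] by simp
  qed (use low b in auto)
  ultimately have "a = b"
    using URED_wrt_asymptotically_nearest_unique[OF K(3,4) a b d] by simp
  moreover have "e \<le> dist b a"
    using Rxy by (intro LIMSEQ_le_const[OF tendsto_dist[OF Rb Ra]]) auto
  ultimately show False
    using e by simp
qed

text \<open>Speaking of "the" nearest point map presupposes existence and uniqueness, so both are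
  part of the conclusion. Values outside the ball are unconstrained, hence uniqueness is meant on
  \<open>cball 0 1\<close>.\<close>

theorem proposition6p7:
  fixes K :: "'a::banach set"
  assumes "K \<noteq> {}" and "K \<subseteq> cball 0 1" and "compact K" and "convex K"
    and "URED_wrt K"
  shows "\<exists>R. nearest_point_map K R
    \<and> (\<forall>S. nearest_point_map K S \<longrightarrow> (\<forall>x \<in> cball 0 1. S x = R x))
    \<and> uniformly_continuous_on (cball 0 1) R"
proof -
  \<comment> \<open>Compactness makes \<open>dist x\<close> attain its minimum on \<open>K\<close>,
    for every \<open>x\<close> of the space; choice then yields a total function
    \<open>R\<close>.\<close>
  have "\<exists>y. y \<in> K \<and> norm (x - y) = infdist x K" for x
  proof -
    have "continuous_on K (dist x)"
      by (intro continuous_intros)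
    then obtain y where y: "y \<in> K" "\<And>w. w \<in> K \<Longrightarrow> dist x y \<le> dist x w"
      using continuous_attains_inf[OF assms(3,1)] by blast
    then have "dist x y \<le> infdist x K"
      by (simp add: infdist_notempty[OF assms(1)] cINF_greatest[OF assms(1)])
    with y(1) show ?thesis
      using infdist_le[OF y(1), of x] by (auto simp: dist_norm)
  qed
  then obtain R where R: "\<And>x. R x \<in> K" "\<And>x. norm (x - R x) = infdist x K"
    by metis
  then have npR: "nearest_point_map K R"
    by (simp add: nearest_point_map_iff_infdist[OF assms(1)])
  moreover have "S x = R x" if "nearest_point_map K S" "x \<in> cball 0 1" for S x
    using that R
    by (intro URED_wrt_asymptotically_nearest_unique[OF assms(4,5), of _ _ "\<lambda>_. x" "infdist x K"])
      (auto simp: nearest_point_map_iff_infdist[OF assms(1)])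
  ultimately show ?thesis
    using nearest_point_map_uniformly_continuous[OF assms npR] by blast
qed

end
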